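(* For every $C>0$ there is $c>0$ such that for every prime $q$ with $q \equiv 3 \pmod 4$ and all sets $E,F \subseteq \mathbb{F}_q^{2+2}$: if $|E||F| > C q^{6+\frac{2}{3}}$, then $|B_{2,2}(E,F)| > c q^2$. Moreover, the exponent $6+\frac23$ cannot be lowered below $6$: for every real $\alpha<6$, the statement "for every $C>0$ there is $c>0$ such that for every prime $q \equiv 3 \pmod 4$ and all $E,F\subseteq \mathbb{F}_q^{2+2}$ with $|E||F|>Cq^{\alpha}$ one has $|B_{2,2}(E,F)|>cq^2$" is false.
   Context: $\mathbb{F}_q$ is the field with $q$ elements. For $x=(x_1,x_2) \in \mathbb{F}_q^2$ write $\Vert x\Vert = x_1^2+x_2^2 \in \mathbb{F}_q$. Write elements of $\mathbb{F}_q^{2+2}=\mathbb{F}_q^4$ as $x=(x',x'')$ with $x',x''\in\mathbb{F}_q^2$. For $E,F \subseteq \mathbb{F}_q^{2+2}$, $$B_{2,2}(E,F)=\{(\Vert x'-y'\Vert, \Vert x''-y''\Vert) : (x',x'')\in E,\ (y',y'')\in F\} \subseteq \mathbb{F}_q\times\mathbb{F}_q.$$ *)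

theory Defs
  imports Complex_Main "HOL-Number_Theory.Residues"
begin

definition sqnorm :: "('a, 'm) ring_scheme \<Rightarrow> 'a \<times> 'a \<Rightarrow> 'a" where
  "sqnorm R x = (fst x [^]\<^bsub>R\<^esub> (2::nat)) \<oplus>\<^bsub>R\<^esub> (snd x [^]\<^bsub>R\<^esub> (2::nat))"

definition vdiff :: "('a, 'm) ring_scheme \<Rightarrow> 'a \<times> 'a \<Rightarrow> 'a \<times> 'a \<Rightarrow> 'a \<times> 'a" where
  "vdiff R x y = (fst x \<ominus>\<^bsub>R\<^esub> fst y, snd x \<ominus>\<^bsub>R\<^esub> snd y)"

definition space22 :: "('a, 'm) ring_scheme \<Rightarrow> (('a \<times> 'a) \<times> ('a \<times> 'a)) set" where
  "space22 R = (carrier R \<times> carrier R) \<times> (carrier R \<times> carrier R)"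

definition B22 :: "('a, 'm) ring_scheme \<Rightarrow> (('a \<times> 'a) \<times> ('a \<times> 'a)) set
    \<Rightarrow> (('a \<times> 'a) \<times> ('a \<times> 'a)) set \<Rightarrow> ('a \<times> 'a) set" where
  "B22 R E F = {(sqnorm R (vdiff R x' y'), sqnorm R (vdiff R x'' y'')) | x' x'' y' y''.
     (x', x'') \<in> E \<and> (y', y'') \<in> F}"

text \<open>The field with q elements for a prime q, as a structure on the integers from 0 to q - 1.
  A carrier-based field is used because the constants in the theorem are uniform in q.\<close>

abbreviation Fq :: "nat \<Rightarrow> int ring" where
  "Fq q \<equiv> residue_ring (int q)"

end

theory Submission
  imports Defs "HOL-Library.Product_Plus" "HOL-Analysis.Convex"
begin

text \<open>
  Since \<open>-1\<close> is not a square, the norm form is anisotropic and vectors of equal norm differ by a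
  rotation. Hence the number of quadruples \<open>x, z \<in> E\<close>, \<open>y, w \<in> F\<close> for which \<open>x - y\<close> and \<open>z - w\<close>
  have the same pair of norms is at most the number of solutions of \<open>x - y = r (z - w)\<close> with \<open>r\<close> in
  \<open>SO(2) \<times> SO(2)\<close>. By Fourier inversion this is the contribution \<open>O(|E|\<^sup>2 |F|\<^sup>2 / q\<^sup>2)\<close> of the zero
  frequency plus \<open>O(q |F|)\<close> times the largest sum of the squared Fourier transform of \<open>1\<^sub>E\<close> over
  a product of two circles (a nonzero frequency has a stabiliser of size \<open>O(q)\<close>). Sums of two points on such a product
  determine the points up to boundedly many harmless coincidences, so duality with the \<open>L\<^sup>4\<close> norm
  bounds that sum by \<open>3 q\<^sup>2 |E| sqrt |E|\<close>, and Cauchy-Schwarz concludes. For the sharpness one takes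
  \<open>E = F = I \<times> {0} \<times> F\<^sub>q\<^sup>2\<close> with an interval \<open>I\<close> of length \<open>\<delta> q\<close>.
\<close>

text \<open>Vectors carry arbitrary integer entries, so polynomial identities hold exactly and
  congruence modulo \<open>q\<close> is imposed separately. Canonical representatives are collected
  in \<open>V\<close> and \<open>W\<close>.\<close>

type_synonym vec2 = "int \<times> int"
type_synonym vec4 = "vec2 \<times> vec2"

text \<open>Euclid's argument: \<open>4 * fact n - 1\<close> is 3 modulo 4, hence has a prime factor
  that is 3 modulo 4, and no prime up to \<open>n\<close> divides it. The sharpness part needs
  arbitrarily large \<open>q\<close>.\<close>

lemma exists_prime_3_mod_4_greater:
  obtains p :: nat where "prime p" "[p = 3] (mod 4)" "p > n"
proof -
  define N :: nat where "N = 4 * fact n - 1"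
  have f: "fact n \<ge> (1::nat)"
    by simp
  have N3: "[N = 3] (mod 4)"
  proof -
    have "N = 3 + 4 * (fact n - 1)"
      using f unfolding N_def by linarith
    then show ?thesis
      by (simp add: cong_def)
  qed
  \<comment> \<open>Prime factors congruent to 1 are stripped off without changing the residue,
    until one congruent to 3 is met.\<close>
  have "\<exists>p. prime p \<and> p dvd m \<and> [p = 3] (mod 4)" if "[m = 3] (mod 4)" for m :: nat
    using that
  proof (induction m rule: less_induct)
    case (less m)
    have m: "m mod 4 = 3"
      using less.prems by (simp add: cong_def)
    then have "m \<noteq> 1"
      by auto
    then obtain p where p: "prime p" "p dvd m"
      using prime_factor_nat by blast
    then obtain k where k: "m = p * k"
      by (elim dvdE)
    from p(1) show ?case
    proof (cases rule: prime_cong_4_nat_cases)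
      case 2
      then have "even m"
        using k by simp
      with m show ?thesis
        by presburger
    next
      case cong_1
      then have "[p * k = 1 * k] (mod 4)"
        by (rule cong_scalar_right)
      then have "[k = 3] (mod 4)"
        using less.prems k by (metis cong_sym cong_trans mult_1)
      moreover have "k < m"
        using k m prime_gt_1_nat[OF p(1)] by (cases "k = 0") auto
      ultimately show ?thesis
        using less.IH[of k] k by auto
    next
      case cong_3
      then show ?thesis
        using p by blast
    qed
  qed
  then obtain p where p: "prime p" "p dvd N" "[p = 3] (mod 4)"
    using N3 by blast
  have "p > n"
  proof (rule ccontr)
    assume "\<not> p > n"
    then have "p dvd 4 * fact n"
      using p(1) by (intro dvd_mult) (simp add: prime_dvd_fact_iff)
    moreover have "4 * fact n = N + 1"
      using f unfolding N_def by linarith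
    ultimately have "p dvd 1"
      using p(2) by (metis dvd_add_right_iff)
    then show False
      using p(1) by auto
  qed
  then show thesis
    using p that by blast
qed

section \<open>Inequalities for finite sums\<close>

text \<open>By AM-GM, \<open>F p\<close> is at most the mean of the squared products over the pairs
  \<open>g p\<close> and \<open>h p\<close>. Injectivity bounds each half by a sum over all of
  \<open>S \<times> S\<close>, which factors. In the application, \<open>p\<close> is a quadruple
  split into two pairs, each determining it.\<close>

lemma sum_le_square_if_inj_on:
  fixes f :: "'a \<Rightarrow> real"
  assumes "finite S" "inj_on g Q" "inj_on h Q" "g ` Q \<subseteq> S \<times> S" "h ` Q \<subseteq> S \<times> S"
    and le: "\<And>p. p \<in> Q \<Longrightarrow> F p = f (fst (g p)) * f (snd (g p)) * (f (fst (h p)) * f (snd (h p)))"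
  shows "sum F Q \<le> (\<Sum>a\<in>S. (f a)\<^sup>2)\<^sup>2"
proof -
  define u where "u = (\<lambda>p. (f (fst p) * f (snd p))\<^sup>2)"
  have tot: "sum u (S \<times> S) = (\<Sum>a\<in>S. (f a)\<^sup>2)\<^sup>2"
    by (simp add: u_def power_mult_distrib sum_product sum.cartesian_product power2_eq_square[of "sum _ _"] case_prod_beta)
  have bound: "(\<Sum>p\<in>Q. u (k p)) \<le> sum u (S \<times> S)" if "inj_on k Q" "k ` Q \<subseteq> S \<times> S" for k
  proof -
    have "(\<Sum>p\<in>Q. u (k p)) = sum u (k ` Q)"
      using that(1) by (simp add: sum.reindex)
    also have "\<dots> \<le> sum u (S \<times> S)"
      using that(2) \<open>finite S\<close> by (intro sum_mono2) (auto simp: u_def)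
    finally show ?thesis .
  qed
  have "sum F Q \<le> (\<Sum>p\<in>Q. (u (g p) + u (h p)) / 2)"
  proof (rule sum_mono)
    fix p assume "p \<in> Q"
    then show "F p \<le> (u (g p) + u (h p)) / 2"
      using le[of p] sum_squares_bound[of "f (fst (g p)) * f (snd (g p))" "f (fst (h p)) * f (snd (h p))"]
      by (simp add: u_def)
  qed
  also have "\<dots> = ((\<Sum>p\<in>Q. u (g p)) + (\<Sum>p\<in>Q. u (h p))) / 2"
    by (simp add: sum.distrib flip: sum_divide_distrib)
  also have "\<dots> \<le> sum u (S \<times> S)"
    using bound[of g] bound[of h] assms by simp
  finally show ?thesis
    by (simp add: tot)
qed

lemma sum_UNION_le:
  fixes F :: "'a \<Rightarrow> real"
  assumes "finite I" "\<And>i. i \<in> I \<Longrightarrow> finite (Q i)" "\<And>x. F x \<ge> 0"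
  shows "sum F (\<Union>i\<in>I. Q i) \<le> (\<Sum>i\<in>I. sum F (Q i))"
  using assms(1,2)
proof (induction I rule: finite_induct)
  case (insert i I)
  have "sum F (Q i \<union> (\<Union>i\<in>I. Q i)) \<le> sum F (Q i) + sum F (\<Union>i\<in>I. Q i)"
    using sum.union_inter[of "Q i" "\<Union>i\<in>I. Q i" F] insert assms(3)
      sum_nonneg[of "Q i \<inter> (\<Union>i\<in>I. Q i)" F] by auto
  then show ?case
    using insert by auto
qed simp

text \<open>Cauchy-Schwarz over the fibres of \<open>\<phi>\<close>: their sizes sum to
  \<open>card J\<close>, and the squares of their sizes count the colliding pairs.\<close>

lemma card_square_le_card_image_mult_collisions:
  assumes "finite J"
  shows "(real (card J))\<^sup>2 \<le> real (card (\<phi> ` J)) * (\<Sum>j\<in>J. \<Sum>k\<in>J. if \<phi> j = \<phi> k then 1 else 0)"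
proof -
  define n where "n = (\<lambda>b. real (card {k \<in> J. \<phi> k = b}))"
  have n: "(\<Sum>k\<in>J. if \<phi> j = \<phi> k then 1 else 0) = n (\<phi> j)" for j
  proof -
    have "(\<Sum>k\<in>J. if \<phi> j = \<phi> k then 1 else 0) = (\<Sum>k | k \<in> J \<and> \<phi> j = \<phi> k. 1::real)"
      using assms by (intro sum.inter_filter[symmetric])
    then show ?thesis
      by (simp add: n_def eq_commute)
  qed
  have group: "(\<Sum>j\<in>J. u (\<phi> j)) = (\<Sum>b\<in>\<phi> ` J. n b * u b)" for u :: "_ \<Rightarrow> real"
  proof -
    have "(\<Sum>j\<in>J. u (\<phi> j)) = (\<Sum>b\<in>\<phi> ` J. \<Sum>j | j \<in> J \<and> \<phi> j = b. u (\<phi> j))"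
      using assms by (intro sum.group[symmetric]) auto
    also have "\<dots> = (\<Sum>b\<in>\<phi> ` J. n b * u b)"
      by (intro sum.cong refl) (simp add: n_def)
    finally show ?thesis .
  qed
  have "(real (card J))\<^sup>2 = (\<Sum>b\<in>\<phi> ` J. n b)\<^sup>2"
    using group[of "\<lambda>_. 1"] by simp
  also have "\<dots> \<le> (\<Sum>b\<in>\<phi> ` J. (n b)\<^sup>2) * real (card (\<phi> ` J))"
    by (rule sum_squared_le_sum_of_squares)
  also have "(\<Sum>b\<in>\<phi> ` J. (n b)\<^sup>2) = (\<Sum>j\<in>J. n (\<phi> j))"
    by (simp add: group power2_eq_square)
  finally show ?thesis
    by (simp add: n mult.commute)
qed

section \<open>Bilinear forms and complex multiplication\<close>

definition dot :: "vec2 \<Rightarrow> vec2 \<Rightarrow> int" where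
  "dot u v = fst u * fst v + snd u * snd v"

text \<open>Multiplication of \<open>a + b i\<close> and \<open>c + d i\<close>; it is a rotation when \<open>a\<^sup>2 + b\<^sup>2 = 1\<close>.\<close>

definition rot :: "vec2 \<Rightarrow> vec2 \<Rightarrow> vec2" where
  "rot r v = (fst r * fst v - snd r * snd v, fst r * snd v + snd r * fst v)"

lemma dot_rot: "dot (rot r u) v = dot u (rot (fst r, - snd r) v)"
  by (simp add: dot_def rot_def algebra_simps)

lemma dot_rot_self: "dot (rot r v) (rot r v) = dot r r * dot v v"
  by (simp add: dot_def rot_def algebra_simps)

definition pairing :: "vec4 \<Rightarrow> vec4 \<Rightarrow> int" where
  "pairing x y = dot (fst x) (fst y) + dot (snd x) (snd y)"

definition rot4 :: "vec4 \<Rightarrow> vec4 \<Rightarrow> vec4" where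
  "rot4 r x = (rot (fst r) (fst x), rot (snd r) (snd x))"

text \<open>Complex conjugation; multiplication by \<open>conj2 r\<close> is the adjoint of
  \<open>rot r\<close> with respect to \<open>dot\<close>.\<close>

definition conj2 :: "vec2 \<Rightarrow> vec2" where
  "conj2 r = (fst r, - snd r)"

definition conj4 :: "vec4 \<Rightarrow> vec4" where
  "conj4 r = (conj2 (fst r), conj2 (snd r))"

lemma pairing_rot4: "pairing (rot4 r x) y = pairing x (rot4 (conj4 r) y)"
  by (simp add: pairing_def rot4_def conj4_def conj2_def dot_rot)

section \<open>Plane geometry over the prime field\<close>

locale prime_3_mod_4 =
  fixes q :: nat
  assumes prime_q: "prime q" and q_mod_4: "[q = 3] (mod 4)"
begin

definition null2 :: "vec2 \<Rightarrow> bool" where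
  "null2 v \<longleftrightarrow> int q dvd fst v \<and> int q dvd snd v"

definition V :: "vec2 set" where
  "V = {0..<int q} \<times> {0..<int q}"

lemma prime_int_q: "prime (int q)"
  using prime_q by simp

lemma q_pos: "q > 0"
  using prime_q prime_gt_0_nat by blast

lemma not_dvd_2: "\<not> int q dvd 2"
proof
  assume "int q dvd 2"
  then have "q dvd 2"
    using int_dvd_int_iff[of q 2] by simp
  then have "q \<le> 2"
    by (simp add: dvd_imp_le)
  moreover have "q mod 4 = 3"
    using q_mod_4 by (simp add: cong_def)
  ultimately show False
    by (cases q) auto
qed

lemma fermat_int:
  assumes "\<not> int q dvd a"
  shows "[a ^ (q - 1) = 1] (mod int q)"
proof -
  define n where "n = nat (a mod int q)"
  have n: "int n = a mod int q"
    using q_pos by (simp add: n_def)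
  have "\<not> q dvd n"
    using assms n by (metis dvd_mod_iff dvd_refl int_dvd_int_iff)
  then have "[n ^ (q - 1) = 1] (mod q)"
    using fermat_theorem prime_q by blast
  then have "[int n ^ (q - 1) = 1] (mod int q)"
    by (metis cong_int_iff of_nat_1 of_nat_power)
  moreover have "[a ^ (q - 1) = int n ^ (q - 1)] (mod int q)"
    by (intro cong_pow) (simp add: n)
  ultimately show ?thesis
    using cong_trans by blast
qed

text \<open>If \<open>a\<^sup>2 = - b\<^sup>2\<close> with \<open>a\<close> nonzero modulo
  \<open>q\<close>, then raising to the power \<open>(q - 1) div 2\<close> and Fermat's theorem give
  1 = -1. The exponent is odd because \<open>q\<close> is 3 modulo 4.\<close>

lemma anisotropic:
  assumes "int q dvd dot v v"
  shows "null2 v"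
proof -
  obtain a b where v: "v = (a, b)"
    by fastforce
  have d: "int q dvd a * a + b * b"
    using assms by (simp add: v dot_def)
  have "int q dvd a"
  proof (rule ccontr)
    assume a: "\<not> int q dvd a"
    have b: "\<not> int q dvd b"
      using a d prime_int_q by (metis dvd_add_left_iff dvd_mult prime_dvd_mult_iff)
    define k where "k = (q - 1) div 2"
    have q3: "q mod 4 = 3"
      using q_mod_4 by (simp add: cong_def)
    have "odd k" and k: "q - 1 = 2 * k"
      unfolding k_def using q3 by presburger+
    have "[a * a = - (b * b)] (mod int q)"
      using d by (simp add: cong_iff_dvd_diff)
    then have "[(a * a) ^ k = (- (b * b)) ^ k] (mod int q)"
      by (rule cong_pow)
    then have "[a ^ (q - 1) = - (b ^ (q - 1))] (mod int q)"
      using \<open>odd k\<close> unfolding k by (simp add: power_mult power2_eq_square)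
    moreover have "[a ^ (q - 1) = 1] (mod int q)" "[b ^ (q - 1) = 1] (mod int q)"
      using a b fermat_int by blast+
    ultimately have "[1 = - 1] (mod int q)"
      by (metis cong_minus_minus_iff cong_sym cong_trans)
    then show False
      using not_dvd_2 by (simp add: cong_iff_dvd_diff)
  qed
  moreover from this have "int q dvd b"
    using d prime_int_q by (metis dvd_add_right_iff dvd_mult prime_dvd_mult_iff)
  ultimately show ?thesis
    by (simp add: v null2_def)
qed

text \<open>By Cramer's rule the determinant \<open>D\<close> of \<open>u\<close> and
  \<open>v\<close> kills \<open>w\<close>, so it vanishes modulo \<open>q\<close> if
  \<open>w\<close> does not. Lagrange's identity then makes the product of the norms of
  \<open>u\<close> and \<open>v\<close> vanish, against anisotropy.\<close>

lemma null2_if_pairwise_orthogonal: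
  assumes "int q dvd dot u v" "int q dvd dot u w" "int q dvd dot v w"
  shows "null2 u \<or> null2 v \<or> null2 w"
proof (rule ccontr)
  assume neg: "\<not> (null2 u \<or> null2 v \<or> null2 w)"
  define D where "D = fst u * snd v - snd u * fst v"
  have "D * fst w = snd v * dot u w - snd u * dot v w"
       "D * snd w = fst u * dot v w - fst v * dot u w"
    by (simp_all add: D_def dot_def algebra_simps)
  then have "int q dvd D * fst w" "int q dvd D * snd w"
    using assms by simp_all
  then have "int q dvd D"
    using neg prime_int_q by (auto simp: null2_def prime_dvd_mult_iff)
  moreover have "dot u u * dot v v = dot u v * dot u v + D * D"
    by (simp add: D_def dot_def algebra_simps)
  ultimately have "int q dvd dot u u * dot v v"
    using assms(1) by simp
  then show False
    using neg anisotropic[of u] anisotropic[of v] prime_dvd_mult_iff[OF prime_int_q] by blast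
qed

text \<open>The three vectors in the conclusion are pairwise orthogonal.\<close>

lemma circle_sum_eq:
  assumes "[dot a a = t] (mod int q)" "[dot b b = t] (mod int q)"
    and "[dot c c = t] (mod int q)" "[dot d d = t] (mod int q)"
    and s: "null2 (a + b - c - d)"
  shows "null2 (a - c) \<or> null2 (a - d) \<or> null2 (a + b)"
proof -
  let ?z = "a + b - c - d"
  have z: "int q dvd dot ?z v" for v
    using s by (simp add: null2_def dot_def)
  have ab: "int q dvd dot a a - dot b b" and ac: "int q dvd dot a a - dot c c"
    and ad: "int q dvd dot a a - dot d d"
    using assms(1-4) by (metis cong_iff_dvd_diff cong_sym cong_trans)+
  have odd: "int q dvd x" if "int q dvd 2 * x" for x
    using that not_dvd_2 prime_int_q by (simp add: prime_dvd_mult_iff)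
  \<comment> \<open>Twice each inner product is a combination of differences of equal norms and of a
    product with the vanishing vector \<open>?z\<close>; the factor 2 is invertible.\<close>
  have "2 * dot (a - c) (a - d) = (dot a a - dot c c) + (dot a a - dot d d) - (dot a a - dot b b)
      - dot ?z (b + c + d - a)"
    by (simp add: dot_def algebra_simps)
  then have "int q dvd dot (a - c) (a - d)"
    using ab ac ad z by (metis dvd_add dvd_diff odd)
  moreover have "2 * dot (a - c) (a + b) = (dot a a - dot b b) + (dot a a - dot c c)
      - (dot a a - dot d d) + dot ?z (d - c + a + b)"
    by (simp add: dot_def algebra_simps)
  then have "int q dvd dot (a - c) (a + b)"
    using ab ac ad z by (metis dvd_add dvd_diff odd)
  moreover have "2 * dot (a - d) (a + b) = (dot a a - dot b b) + (dot a a - dot d d)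
      - (dot a a - dot c c) + dot ?z (c - d + a + b)"
    by (simp add: dot_def algebra_simps)
  then have "int q dvd dot (a - d) (a + b)"
    using ab ac ad z by (metis dvd_add dvd_diff odd)
  ultimately show ?thesis
    using null2_if_pairwise_orthogonal by blast
qed

section \<open>Fourier analysis\<close>

definition null4 :: "vec4 \<Rightarrow> bool" where
  "null4 v \<longleftrightarrow> null2 (fst v) \<and> null2 (snd v)"

definition W :: "vec4 set" where
  "W = V \<times> V"

lemma finite_V [simp]: "finite V" and finite_W [simp]: "finite W"
  by (simp_all add: V_def W_def)

lemma eq_if_null2_diff:
  assumes "u \<in> V" "v \<in> V" "null2 (u - v)"
  shows "u = v"
proof -
  have "fst u mod int q = fst v mod int q" "snd u mod int q = snd v mod int q"
    using assms(3) by (simp_all add: null2_def mod_eq_dvd_iff)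
  then show ?thesis
    using assms(1,2) by (auto simp: V_def)
qed

lemma eq_if_null4_diff:
  assumes "u \<in> W" "v \<in> W" "null4 (u - v)"
  shows "u = v"
  using assms eq_if_null2_diff by (auto simp: W_def null4_def)

text \<open>The standard additive character of the prime field, lifted to all integers.\<close>

definition e :: "int \<Rightarrow> complex" where
  "e n = cis (2 * pi * real_of_int n / real q)"

lemma e_add: "e (m + n) = e m * e n"
  by (simp add: e_def cis_mult add_divide_distrib distrib_left)

lemma cnj_e: "cnj (e n) = e (- n)"
  by (simp add: e_def cis_cnj)

lemma e_eq_1_if_dvd:
  assumes "int q dvd n"
  shows "e n = 1"
proof -
  obtain k where "n = int q * k"
    using assms by (elim dvdE)
  then have "2 * pi * real_of_int n / real q = 2 * pi * real_of_int k"
    using q_pos by simp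
  then show ?thesis
    unfolding e_def by (metis Ints_of_int cis_multiple_2pi)
qed

lemma e_cong: "[m = n] (mod int q) \<Longrightarrow> e m = e n"
  using e_add[of n "m - n"] e_eq_1_if_dvd[of "m - n"] by (simp add: cong_iff_dvd_diff)

lemma e_neq_1:
  assumes "\<not> int q dvd n"
  shows "e n \<noteq> 1"
proof
  assume "e n = 1"
  then have "cos (2 * pi * real_of_int n / real q) = 1"
    by (simp add: e_def complex_eq_iff)
  then obtain k :: int where "2 * pi * real_of_int n / real q = real_of_int k * 2 * pi"
    using cos_one_2pi_int by auto
  then have "real_of_int n = real_of_int k * real q"
    using q_pos by (simp add: field_simps)
  then have "n = k * int q"
    by (metis of_int_eq_iff of_int_mult of_int_of_nat_eq)
  then show False
    using assms by simp
qed

lemma e_power: "e n ^ k = e (n * int k)"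
  by (simp add: e_def DeMoivre mult_ac)

lemma sum_e: "(\<Sum>k\<in>{0..<int q}. e (n * k)) = (if int q dvd n then of_nat q else 0)"
proof -
  have "(\<Sum>k\<in>{0..<int q}. e (n * k)) = (\<Sum>k<q. e n ^ k)"
    by (rule sum.reindex_bij_witness[where i = int and j = nat]) (auto simp: e_power)
  also have "\<dots> = (if int q dvd n then of_nat q else 0)"
  proof (cases "int q dvd n")
    case True
    then show ?thesis
      by (simp add: e_eq_1_if_dvd)
  next
    case False
    have "e n ^ q = 1"
      by (simp add: e_power e_eq_1_if_dvd)
    then show ?thesis
      using False e_neq_1 by (simp add: geometric_sum)
  qed
  finally show ?thesis .
qed

lemma sum_e_dot: "(\<Sum>x\<in>V. e (dot v x)) = (if null2 v then of_nat q ^ 2 else 0)"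
proof -
  have "(\<Sum>x\<in>V. e (dot v x)) =
      (\<Sum>k\<in>{0..<int q}. e (fst v * k)) * (\<Sum>l\<in>{0..<int q}. e (snd v * l))"
    by (simp add: V_def dot_def e_add sum_product sum.cartesian_product case_prod_beta)
  then show ?thesis
    by (simp add: sum_e null2_def power2_eq_square)
qed

lemma sum_e_pairing: "(\<Sum>x\<in>W. e (pairing v x)) = (if null4 v then of_nat q ^ 4 else 0)"
proof -
  have "(\<Sum>x\<in>W. e (pairing v x)) = (\<Sum>y\<in>V. e (dot (fst v) y)) * (\<Sum>z\<in>V. e (dot (snd v) z))"
    by (simp add: W_def pairing_def e_add sum_product sum.cartesian_product case_prod_beta)
  then show ?thesis
    by (simp add: sum_e_dot null4_def flip: power_add)
qed

text \<open>Expanding the product leaves character sums, evaluated by \<open>sum_e_pairing\<close>.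
  Frequencies form indexed families that may repeat, so the same identity serves points of a set,
  sums of two points on a sphere, and rotated differences.\<close>

lemma parseval:
  fixes c :: "'j \<Rightarrow> complex" and d :: "'k \<Rightarrow> complex"
  shows "(\<Sum>x\<in>W. (\<Sum>j\<in>J. c j * e (pairing (v j) x)) * cnj (\<Sum>k\<in>K. d k * e (pairing (w k) x))) =
    of_nat q ^ 4 * (\<Sum>j\<in>J. \<Sum>k\<in>K. if null4 (v j - w k) then c j * cnj (d k) else 0)"
proof -
  have "(\<Sum>x\<in>W. (\<Sum>j\<in>J. c j * e (pairing (v j) x)) * cnj (\<Sum>k\<in>K. d k * e (pairing (w k) x)))
      = (\<Sum>x\<in>W. \<Sum>j\<in>J. \<Sum>k\<in>K. c j * cnj (d k) * e (pairing (v j - w k) x))"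
  proof (rule sum.cong[OF refl])
    fix x
    have "e (pairing (v j - w k) x) = e (pairing (v j) x) * cnj (e (pairing (w k) x))" for j k
      by (simp add: cnj_e pairing_def dot_def algebra_simps flip: e_add)
    then show "(\<Sum>j\<in>J. c j * e (pairing (v j) x)) * cnj (\<Sum>k\<in>K. d k * e (pairing (w k) x))
      = (\<Sum>j\<in>J. \<Sum>k\<in>K. c j * cnj (d k) * e (pairing (v j - w k) x))"
      by (simp add: sum_product mult_ac)
  qed
  also have "\<dots> = (\<Sum>j\<in>J. \<Sum>x\<in>W. \<Sum>k\<in>K. c j * cnj (d k) * e (pairing (v j - w k) x))"
    by (rule sum.swap)
  also have "\<dots> = (\<Sum>j\<in>J. \<Sum>k\<in>K. \<Sum>x\<in>W. c j * cnj (d k) * e (pairing (v j - w k) x))"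
    by (intro sum.cong refl sum.swap)
  also have "\<dots> = (\<Sum>j\<in>J. \<Sum>k\<in>K. c j * cnj (d k) * (\<Sum>x\<in>W. e (pairing (v j - w k) x)))"
    by (simp add: sum_distrib_left)
  also have "\<dots> = of_nat q ^ 4 * (\<Sum>j\<in>J. \<Sum>k\<in>K. if null4 (v j - w k) then c j * cnj (d k) else 0)"
    unfolding sum_e_pairing sum_distrib_left by (intro sum.cong refl) simp
  finally show ?thesis .
qed

text \<open>The Fourier transform of the indicator function of \<open>A\<close>, unnormalised and
  with a positive sign in the exponent.\<close>

definition hat :: "vec4 set \<Rightarrow> vec4 \<Rightarrow> complex" where
  "hat A \<xi> = (\<Sum>x\<in>A. e (pairing x \<xi>))"

lemma plancherel:
  assumes "A \<subseteq> W"
  shows "(\<Sum>\<xi>\<in>W. (cmod (hat A \<xi>))\<^sup>2) = real q ^ 4 * real (card A)"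
proof -
  have "finite A"
    using assms finite_W finite_subset by blast
  have "complex_of_real (\<Sum>\<xi>\<in>W. (cmod (hat A \<xi>))\<^sup>2) = (\<Sum>\<xi>\<in>W. hat A \<xi> * cnj (hat A \<xi>))"
    by (simp only: of_real_sum complex_norm_square)
  also have "\<dots> = of_nat q ^ 4 * (\<Sum>j\<in>A. \<Sum>k\<in>A. if null4 (j - k) then 1 else 0)"
    using parseval[where J = A and K = A and c = "\<lambda>_. 1" and d = "\<lambda>_. 1" and v = "\<lambda>x. x" and w = "\<lambda>x. x"]
    by (simp add: hat_def cong: if_cong)
  also have "(\<Sum>j\<in>A. \<Sum>k\<in>A. if null4 (j - k) then 1 else (0::complex)) =
      (\<Sum>j\<in>A. \<Sum>k\<in>A. if j = k then 1 else 0)"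
  proof (intro sum.cong refl if_cong)
    fix j k assume "j \<in> A" "k \<in> A"
    then show "null4 (j - k) = (j = k)"
      using assms eq_if_null4_diff[of j k] by (auto simp: null4_def null2_def)
  qed
  also have "\<dots> = of_nat (card A)"
    using \<open>finite A\<close> by simp
  finally have "complex_of_real (\<Sum>\<xi>\<in>W. (cmod (hat A \<xi>))\<^sup>2) =
      complex_of_real (real q ^ 4 * real (card A))"
    by simp
  then show ?thesis
    using of_real_eq_iff by blast
qed

section \<open>Restriction to products of circles\<close>

text \<open>Despite the name this is a product of two plane circles, with \<open>t\<close> and
  \<open>s\<close> as squared radii.\<close>

definition sphere :: "int \<Rightarrow> int \<Rightarrow> vec4 set" where
  "sphere t s = {a \<in> W. [dot (fst a) (fst a) = t] (mod int q) \<and> [dot (snd a) (snd a) = s] (mod int q)}"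

definition neg2 :: "vec2 \<Rightarrow> vec2" where
  "neg2 v = ((- fst v) mod int q, (- snd v) mod int q)"

text \<open>The three ways in which \<open>a + b = c + d\<close> can hold on a circle.\<close>

fun pattern :: "nat \<Rightarrow> vec2 \<Rightarrow> vec2 \<Rightarrow> vec2 \<Rightarrow> vec2 \<Rightarrow> bool" where
  "pattern 0 a b c d \<longleftrightarrow> c = a \<and> d = b"
| "pattern (Suc 0) a b c d \<longleftrightarrow> c = b \<and> d = a"
| "pattern (Suc (Suc _)) a b c d \<longleftrightarrow> b = neg2 a \<and> a = neg2 b \<and> d = neg2 c \<and> c = neg2 d"

text \<open>Two facts for each splitting of the quadruple into pairs, giving the injectivity that
  \<open>energy_le\<close> needs. The last pattern states its equations in both directions so that
  either vector of an antipodal pair yields the other.\<close>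

lemma pattern_determined:
  shows "i \<in> {0, 1} \<Longrightarrow> pattern i a b c d \<Longrightarrow> pattern i a b c' d' \<Longrightarrow> c = c' \<and> d = d'"
    and "i \<in> {0, 1} \<Longrightarrow> pattern i a b c d \<Longrightarrow> pattern i a' b' c d \<Longrightarrow> a = a' \<and> b = b'"
    and "i \<in> {0, 2} \<Longrightarrow> pattern i a b c d \<Longrightarrow> pattern i a b' c' d \<Longrightarrow> b = b' \<and> c = c'"
    and "i \<in> {0, 2} \<Longrightarrow> pattern i a b c d \<Longrightarrow> pattern i a' b c d' \<Longrightarrow> a = a' \<and> d = d'"
    and "i \<in> {1, 2} \<Longrightarrow> pattern i a b c d \<Longrightarrow> pattern i a b' c d' \<Longrightarrow> b = b' \<and> d = d'"
    and "i \<in> {1, 2} \<Longrightarrow> pattern i a b c d \<Longrightarrow> pattern i a' b c' d \<Longrightarrow> a = a' \<and> c = c'"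
  by (elim insertE emptyE; metis One_nat_def numeral_2_eq_2 pattern.simps)+

lemma neg2_eqI:
  assumes "v \<in> V" "null2 (u + v)"
  shows "v = neg2 u"
proof -
  have "neg2 u \<in> V"
    using q_pos by (simp add: neg2_def V_def)
  moreover have "null2 (v - neg2 u)"
    using assms(2) by (simp add: null2_def neg2_def mod_eq_0_iff_dvd[symmetric] mod_simps add.commute)
  ultimately show ?thesis
    using assms(1) eq_if_null2_diff by blast
qed

text \<open>Turns the trichotomy of \<open>circle_sum_eq\<close> into equalities of representatives;
  once one coincidence is known, the relation between the sums forces the second.\<close>

lemma circle_pattern:
  assumes "a \<in> V" "b \<in> V" "c \<in> V" "d \<in> V"
    and "[dot a a = t] (mod int q)" "[dot b b = t] (mod int q)"
    and "[dot c c = t] (mod int q)" "[dot d d = t] (mod int q)"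
    and s: "null2 (a + b - c - d)"
  shows "\<exists>i\<in>{0,1,2}. pattern i a b c d"
proof -
  consider "null2 (a - c)" | "null2 (a - d)" | "null2 (a + b)"
    using circle_sum_eq assms by blast
  then show ?thesis
  proof cases
    case 1
    then have "c = a"
      using assms eq_if_null2_diff by blast
    then have "d = b"
      using s assms eq_if_null2_diff[of b d] by simp
    then show ?thesis
      using \<open>c = a\<close> by simp
  next
    case 2
    then have "d = a"
      using assms eq_if_null2_diff by blast
    then have "c = b"
      using s assms eq_if_null2_diff[of b c] by (simp add: algebra_simps)
    then show ?thesis
      using \<open>d = a\<close> by simp
  next
    case 3
    have "null2 (c + d)"
      using 3 s by (auto simp: null2_def algebra_simps dvd_diff_right_iff dest!: dvd_diff)
    then have "pattern (Suc (Suc 0)) a b c d"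
      using 3 assms neg2_eqI by (simp add: add.commute)
    then show ?thesis
      by (metis insertCI numeral_2_eq_2)
  qed
qed

text \<open>Any two of the three patterns admit a common splitting of \<open>{a, b, c, d}\<close> into two pairs
  each of which determines the whole quadruple, so AM-GM applies to the products over these pairs.\<close>

lemma energy_le:
  fixes f :: "vec4 \<Rightarrow> real" and t s :: int
  assumes "\<And>a. f a \<ge> 0"
  defines "S \<equiv> sphere t s"
  shows "(\<Sum>(a, b)\<in>S \<times> S. \<Sum>(c, d)\<in>S \<times> S. if null4 (a + b - (c + d)) then f a * f b * (f c * f d) else 0)
    \<le> 9 * (\<Sum>a\<in>S. (f a)\<^sup>2)\<^sup>2"
proof -
  have fin: "finite S"
    by (simp add: S_def sphere_def)
  define F where "F = (\<lambda>((a, b), (c, d)). f a * f b * (f c * f d))"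
  \<comment> \<open>The two planes behave independently, so a quadruple has a pattern
    \<open>i\<close> in the first and \<open>j\<close> in the second. The nine combinations, which
    may overlap, account for the constant 9.\<close>
  define Q where "Q = (\<lambda>(i, j). {((a, b), (c, d)) \<in> (S \<times> S) \<times> (S \<times> S).
    pattern i (fst a) (fst b) (fst c) (fst d) \<and> pattern j (snd a) (snd b) (snd c) (snd d)})"
  let ?R = "{p \<in> (S \<times> S) \<times> (S \<times> S). null4 (fst (fst p) + snd (fst p) - (fst (snd p) + snd (snd p)))}"
  let ?I = "{0, 1, 2::nat} \<times> {0, 1, 2::nat}"
  have F_nonneg: "F p \<ge> 0" for p
    using assms(1) by (simp add: F_def case_prod_beta)
  have finQ: "finite (Q ij)" for ij
    by (rule finite_subset[of _ "(S \<times> S) \<times> (S \<times> S)"]) (use fin in \<open>auto simp: Q_def\<close>)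
  have Q_le: "sum F (Q ij) \<le> (\<Sum>a\<in>S. (f a)\<^sup>2)\<^sup>2" if ij: "ij \<in> ?I" for ij
  proof -
    obtain i j where [simp]: "ij = (i, j)"
      by fastforce
    let ?inj = "\<lambda>k. inj_on k (Q (i, j))"
    let ?g1 = "\<lambda>((a, b), (c, d)). (a, b)" and ?h1 = "\<lambda>((a, b), (c, d)). (c, d)"
    let ?g2 = "\<lambda>((a, b), (c, d)). (a, d)" and ?h2 = "\<lambda>((a, b), (c, d)). (b, c)"
    let ?g3 = "\<lambda>((a, b), (c, d)). (a, c)" and ?h3 = "\<lambda>((a, b), (c, d)). (b, d)"
    \<comment> \<open>The splitting is chosen to suit both patterns at once: pairs \<open>ab\<close>
      and \<open>cd\<close>, then \<open>ad\<close> and \<open>bc\<close>, then \<open>ac\<close>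
      and \<open>bd\<close>.\<close>
    consider "i \<in> {0, 1}" "j \<in> {0, 1}" | "i \<in> {0, 2}" "j \<in> {0, 2}" | "i \<in> {1, 2}" "j \<in> {1, 2}"
      using ij by auto
    then show ?thesis
    proof cases
      case 1
      have "?inj ?g1" "?inj ?h1"
        unfolding inj_on_def Q_def
        by (auto simp: prod_eq_iff dest: pattern_determined(1)[OF 1(1)] pattern_determined(1)[OF 1(2)]
            pattern_determined(2)[OF 1(1)] pattern_determined(2)[OF 1(2)])
      then show ?thesis
        using fin by (intro sum_le_square_if_inj_on[where g = ?g1 and h = ?h1]) (auto simp: Q_def F_def)
    next
      case 2
      have "?inj ?g2" "?inj ?h2"
        unfolding inj_on_def Q_def
        by (auto simp: prod_eq_iff dest: pattern_determined(3)[OF 2(1)] pattern_determined(3)[OF 2(2)]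
            pattern_determined(4)[OF 2(1)] pattern_determined(4)[OF 2(2)])
      then show ?thesis
        using fin by (intro sum_le_square_if_inj_on[where g = ?g2 and h = ?h2]) (auto simp: Q_def F_def)
    next
      case 3
      have "?inj ?g3" "?inj ?h3"
        unfolding inj_on_def Q_def
        by (auto simp: prod_eq_iff dest: pattern_determined(5)[OF 3(1)] pattern_determined(5)[OF 3(2)]
            pattern_determined(6)[OF 3(1)] pattern_determined(6)[OF 3(2)])
      then show ?thesis
        using fin by (intro sum_le_square_if_inj_on[where g = ?g3 and h = ?h3]) (auto simp: Q_def F_def)
    qed
  qed
  have cover: "?R \<subseteq> (\<Union>ij\<in>?I. Q ij)"
  proof (rule subsetI)
    fix p assume p: "p \<in> ?R"
    obtain a b c d where abcd: "p = ((a, b), (c, d))"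
      by (metis surj_pair)
    have "\<exists>i\<in>{0,1,2}. pattern i (fst a) (fst b) (fst c) (fst d)"
      using p unfolding abcd
      by (intro circle_pattern[where t = t]) (auto simp: S_def sphere_def W_def null4_def algebra_simps)
    then obtain i where i: "i \<in> {0,1,2}" "pattern i (fst a) (fst b) (fst c) (fst d)"
      by blast
    have "\<exists>j\<in>{0,1,2}. pattern j (snd a) (snd b) (snd c) (snd d)"
      using p unfolding abcd
      by (intro circle_pattern[where t = s]) (auto simp: S_def sphere_def W_def null4_def algebra_simps)
    then obtain j where j: "j \<in> {0,1,2}" "pattern j (snd a) (snd b) (snd c) (snd d)"
      by blast
    have "(i, j) \<in> ?I"
      using i(1) j(1) by (rule SigmaI)
    moreover have "p \<in> Q (i, j)"
      using p i(2) j(2) unfolding abcd Q_def by simp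
    ultimately show "p \<in> (\<Union>ij\<in>?I. Q ij)"
      by blast
  qed
  have "(\<Sum>(a, b)\<in>S \<times> S. \<Sum>(c, d)\<in>S \<times> S. if null4 (a + b - (c + d)) then f a * f b * (f c * f d) else 0)
     = (\<Sum>p\<in>(S \<times> S) \<times> (S \<times> S). if null4 (fst (fst p) + snd (fst p) - (fst (snd p) + snd (snd p))) then F p else 0)"
    by (simp add: F_def sum.cartesian_product case_prod_beta cong: if_cong)
  also have "\<dots> = sum F ?R"
    using fin by (intro sum.inter_filter[symmetric]) simp
  also have "\<dots> \<le> sum F (\<Union>ij\<in>?I. Q ij)"
    using cover fin F_nonneg finQ by (intro sum_mono2) auto
  also have "\<dots> \<le> (\<Sum>ij\<in>?I. sum F (Q ij))"
    using finQ F_nonneg by (intro sum_UNION_le) auto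
  also have "\<dots> \<le> (\<Sum>ij\<in>?I. (\<Sum>a\<in>S. (f a)\<^sup>2)\<^sup>2)"
    by (intro sum_mono Q_le)
  also have "\<dots> = 9 * (\<Sum>a\<in>S. (f a)\<^sup>2)\<^sup>2"
    by simp
  finally show ?thesis .
qed

text \<open>With \<open>h\<close> the inverse transform of \<open>hat A\<close> cut off to the sphere, the left hand side is the
  square of the sum of \<open>h\<close> over \<open>A\<close>; Hoelder reduces it to the \<open>L\<^sup>4\<close> norm of \<open>h\<close>.\<close>

lemma restriction:
  assumes A: "A \<subseteq> W"
  shows "(\<Sum>\<xi>\<in>sphere t s. (cmod (hat A \<xi>))\<^sup>2)\<^sup>2 \<le> 9 * real q ^ 4 * real (card A) ^ 3"
proof -
  define S where "S = sphere t s"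
  define \<sigma> where "\<sigma> = (\<Sum>\<xi>\<in>S. (cmod (hat A \<xi>))\<^sup>2)"
  define c where "c = (\<lambda>\<xi>. cnj (hat A \<xi>))"
  define h where "h = (\<lambda>x. \<Sum>\<xi>\<in>S. c \<xi> * e (pairing \<xi> x))"
  have comm: "pairing x y = pairing y x" for x y
    by (simp add: pairing_def dot_def mult.commute)
  have "complex_of_real \<sigma> = (\<Sum>\<xi>\<in>S. hat A \<xi> * c \<xi>)"
    by (simp only: \<sigma>_def c_def of_real_sum complex_norm_square)
  also have "\<dots> = (\<Sum>\<xi>\<in>S. \<Sum>x\<in>A. c \<xi> * e (pairing \<xi> x))"
    by (simp add: hat_def sum_distrib_right sum_distrib_left comm mult.commute)
  also have "\<dots> = (\<Sum>x\<in>A. h x)"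
    unfolding h_def by (rule sum.swap)
  finally have "cmod (complex_of_real \<sigma>) = cmod (\<Sum>x\<in>A. h x)"
    by simp
  moreover have "\<sigma> \<ge> 0"
    by (simp add: \<sigma>_def sum_nonneg)
  ultimately have \<sigma>_le: "\<sigma> \<le> (\<Sum>x\<in>A. cmod (h x))"
    using norm_sum[of h A] by simp
  \<comment> \<open>The square of \<open>h\<close> is an exponential sum over pair sums, so
    \<open>parseval\<close> turns the fourth moment of \<open>h\<close> into a weighted additive
    energy of the sphere.\<close>
  have sq: "h x ^ 2 = (\<Sum>p\<in>S \<times> S. c (fst p) * c (snd p) * e (pairing (fst p + snd p) x))" for x
  proof -
    have "e (pairing (a + b) x) = e (pairing a x) * e (pairing b x)" for a b
      by (simp add: pairing_def dot_def algebra_simps flip: e_add)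
    then show ?thesis
      by (simp add: h_def power2_eq_square sum_product sum.cartesian_product case_prod_beta mult_ac)
  qed
  have "complex_of_real (\<Sum>x\<in>W. cmod (h x) ^ 4) = (\<Sum>x\<in>W. h x ^ 2 * cnj (h x ^ 2))"
    by (simp only: complex_norm_square[symmetric] norm_power of_real_sum) (simp flip: power_mult)
  also have "\<dots> = of_nat q ^ 4 * (\<Sum>p\<in>S \<times> S. \<Sum>r\<in>S \<times> S. if null4 (fst p + snd p - (fst r + snd r))
      then c (fst p) * c (snd p) * cnj (c (fst r) * c (snd r)) else 0)"
    unfolding sq by (rule parseval)
  finally have "cmod (complex_of_real (\<Sum>x\<in>W. cmod (h x) ^ 4)) = real q ^ 4 * cmod (\<Sum>p\<in>S \<times> S. \<Sum>r\<in>S \<times> S.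
      if null4 (fst p + snd p - (fst r + snd r))
      then c (fst p) * c (snd p) * cnj (c (fst r) * c (snd r)) else 0)"
    by (simp add: norm_mult norm_power)
  then have "(\<Sum>x\<in>W. cmod (h x) ^ 4) = real q ^ 4 * cmod (\<Sum>p\<in>S \<times> S. \<Sum>r\<in>S \<times> S.
      if null4 (fst p + snd p - (fst r + snd r))
      then c (fst p) * c (snd p) * cnj (c (fst r) * c (snd r)) else 0)"
    by (simp add: sum_nonneg del: of_real_sum)
  also have "\<dots> \<le> real q ^ 4 * (\<Sum>p\<in>S \<times> S. \<Sum>r\<in>S \<times> S. if null4 (fst p + snd p - (fst r + snd r))
      then cmod (c (fst p)) * cmod (c (snd p)) * (cmod (c (fst r)) * cmod (c (snd r))) else 0)"
    by (intro mult_left_mono sum_norm_le) (auto simp: norm_mult)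
  also have "\<dots> \<le> real q ^ 4 * (9 * (\<Sum>a\<in>S. (cmod (c a))\<^sup>2)\<^sup>2)"
    unfolding S_def using energy_le[of "\<lambda>a. cmod (c a)" t s] by (intro mult_left_mono) (simp_all add: case_prod_beta)
  finally have L4: "(\<Sum>x\<in>W. cmod (h x) ^ 4) \<le> real q ^ 4 * (9 * \<sigma>\<^sup>2)"
    by (simp add: c_def \<sigma>_def)
  let ?n = "real (card A)"
  \<comment> \<open>Hoelder's inequality in the form of Cauchy-Schwarz applied twice.\<close>
  have "\<sigma>\<^sup>2 \<le> (\<Sum>x\<in>A. cmod (h x))\<^sup>2"
    using \<sigma>_le \<open>\<sigma> \<ge> 0\<close> by (rule power_mono)
  also have "\<dots> \<le> (\<Sum>x\<in>A. cmod (h x) ^ 2) * ?n"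
    by (rule sum_squared_le_sum_of_squares)
  finally have "(\<sigma>\<^sup>2)\<^sup>2 \<le> ((\<Sum>x\<in>A. cmod (h x) ^ 2) * ?n)\<^sup>2"
    by (rule power_mono) simp
  also have "\<dots> = (\<Sum>x\<in>A. cmod (h x) ^ 2)\<^sup>2 * ?n\<^sup>2"
    by (rule power_mult_distrib)
  also have "\<dots> \<le> ((\<Sum>x\<in>A. (cmod (h x) ^ 2) ^ 2) * ?n) * ?n\<^sup>2"
    by (intro mult_right_mono sum_squared_le_sum_of_squares) simp
  also have "\<dots> = (\<Sum>x\<in>A. cmod (h x) ^ 4) * ?n ^ 3"
    by (simp add: power2_eq_square power3_eq_cube power4_eq_xxxx mult.assoc)
  also have "\<dots> \<le> (\<Sum>x\<in>W. cmod (h x) ^ 4) * ?n ^ 3"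
    using A by (intro mult_right_mono sum_mono2) auto
  also have "\<dots> \<le> (real q ^ 4 * (9 * \<sigma>\<^sup>2)) * ?n ^ 3"
    by (intro mult_right_mono L4) simp
  \<comment> \<open>The energy bound returns a factor \<open>\<sigma>\<^sup>2\<close>, which cancels
    unless \<open>\<sigma>\<close> is zero.\<close>
  finally have K: "\<sigma>\<^sup>2 * \<sigma>\<^sup>2 \<le> (9 * real q ^ 4 * ?n ^ 3) * \<sigma>\<^sup>2"
    by (simp add: power2_eq_square mult_ac)
  have "\<sigma>\<^sup>2 \<le> 9 * real q ^ 4 * ?n ^ 3"
  proof (cases "\<sigma> = 0")
    case False
    then show ?thesis
      by (intro mult_right_le_imp_le[OF K]) simp
  qed simp
  then show ?thesis
    by (simp add: \<sigma>_def S_def)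
qed

section \<open>Rotations\<close>

definition SO2 :: "vec2 set" where
  "SO2 = {r \<in> V. [dot r r = 1] (mod int q)}"

text \<open>Rotations over the integers leave \<open>V\<close>; reduction brings the images back to
  representatives.\<close>

definition red2 :: "vec2 \<Rightarrow> vec2" where
  "red2 v = (fst v mod int q, snd v mod int q)"

definition red4 :: "vec4 \<Rightarrow> vec4" where
  "red4 x = (red2 (fst x), red2 (snd x))"

lemma finite_SO2 [simp]: "finite SO2"
  by (simp add: SO2_def)

lemma red2_in_V: "red2 v \<in> V"
  using q_pos by (simp add: red2_def V_def)

lemma red2_eq_iff: "red2 u = red2 v \<longleftrightarrow> null2 (u - v)"
  by (simp add: red2_def null2_def mod_eq_dvd_iff)

lemma dot_red2: "[dot (red2 v) (red2 v) = dot v v] (mod int q)"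
  unfolding dot_def red2_def by (intro cong_add cong_mult) simp_all

lemma null2_diff_rot_red2: "null2 (u - rot (red2 r) v) \<longleftrightarrow> null2 (u - rot r v)"
proof -
  have "[fst (rot (red2 r) v) = fst (rot r v)] (mod int q)"
      "[snd (rot (red2 r) v) = snd (rot r v)] (mod int q)"
    unfolding rot_def red2_def by (auto intro!: cong_add cong_diff cong_mult)
  then show ?thesis
    by (simp add: null2_def cong_def flip: mod_eq_dvd_iff)
qed

text \<open>As complex numbers, vectors of equal nonzero norm have a quotient of norm one. If the
  norm vanishes, anisotropy makes both vectors null and the identity \<open>(1, 0)\<close>
  works.\<close>

lemma exists_rotation:
  assumes uv: "[dot u u = dot v v] (mod int q)"
  shows "\<exists>r\<in>SO2. null2 (u - rot r v)"
proof (cases "int q dvd dot v v")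
  case True
  then have "int q dvd dot u u"
    using uv by (simp add: cong_dvd_iff)
  with True have "null2 u" "null2 v"
    using anisotropic by blast+
  then have "null2 (u - rot (1, 0) v)"
    by (simp add: null2_def rot_def)
  moreover have "(1, 0) \<in> SO2"
    using prime_gt_1_nat[OF prime_q] by (simp add: SO2_def V_def dot_def)
  ultimately show ?thesis
    by blast
next
  case False
  then have "coprime (dot v v) (int q)"
    using prime_int_q by (metis coprime_commute prime_imp_coprime)
  then obtain s where s: "[dot v v * s = 1] (mod int q)"
    using cong_solve_coprime_int by blast
  \<comment> \<open>\<open>u / v\<close> as a quotient of complex numbers\<close>
  define w where "w = (s * dot u v, s * (snd u * fst v - fst u * snd v))"
  have "dot w w = (dot v v * s) * (s * dot u u)"
    by (simp add: w_def dot_def algebra_simps)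
  moreover have "[(dot v v * s) * (s * dot u u) = 1 * (s * dot v v)] (mod int q)"
    by (intro cong_mult s cong_scalar_left uv)
  ultimately have "[dot w w = 1] (mod int q)"
    using s by (simp add: mult.commute) (metis cong_trans)
  then have "red2 w \<in> SO2"
    using dot_red2[of w] red2_in_V by (auto simp: SO2_def intro: cong_trans)
  moreover have "fst (u - rot w v) = fst u * (1 - dot v v * s)"
      "snd (u - rot w v) = snd u * (1 - dot v v * s)"
    by (simp_all add: w_def rot_def dot_def algebra_simps)
  then have "null2 (u - rot w v)"
    unfolding null2_def using s by (simp add: cong_iff_dvd_diff dvd_diff_commute)
  ultimately show ?thesis
    using null2_diff_rot_red2 by blast
qed

text \<open>The norm is multiplicative, so the difference of the two images has norm equal to that
  of \<open>r - r'\<close> times that of \<open>v\<close>. Anisotropy is used for both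
  factors.\<close>

lemma rotation_unique:
  assumes "r \<in> SO2" "r' \<in> SO2" "\<not> null2 v" "null2 (rot (conj2 r) v - rot (conj2 r') v)"
  shows "r = r'"
proof -
  let ?d = "rot (conj2 r) v - rot (conj2 r') v"
  have "dot ?d ?d = dot (r - r') (r - r') * dot v v"
    by (simp add: dot_def rot_def conj2_def algebra_simps)
  moreover have "int q dvd dot ?d ?d"
    using assms(4) by (simp add: null2_def dot_def)
  ultimately have "int q dvd dot (r - r') (r - r')"
    using assms(3) anisotropic prime_int_q by (metis prime_dvd_mult_iff)
  then show ?thesis
    using assms(1,2) anisotropic eq_if_null2_diff by (simp add: SO2_def)
qed

text \<open>Each first coordinate leaves a quadratic equation for the second, with at most two
  roots.\<close>

lemma card_SO2_le: "card SO2 \<le> 2 * q"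
proof -
  let ?R = "\<lambda>a. {b \<in> {0..<int q}. [a * a + b * b = 1] (mod int q)}"
  have "card (?R a) \<le> 2" for a
  proof (cases "?R a = {}")
    case True
    then show ?thesis
      by (metis card.empty zero_le)
  next
    case False
    then obtain c where c: "c \<in> ?R a"
      by blast
    have "b \<in> {c, (- c) mod int q}" if b: "b \<in> ?R a" for b
    proof -
      have "[a * a + b * b = a * a + c * c] (mod int q)"
        using b c by (auto intro: cong_trans cong_sym)
      then have "int q dvd b * b - c * c"
        by (simp add: cong_iff_dvd_diff)
      then have "int q dvd (b - c) * (b + c)"
        by (simp add: algebra_simps)
      then have "int q dvd b - c \<or> int q dvd b - (- c)"
        using prime_int_q by (simp add: prime_dvd_mult_iff)
      then have "b mod int q = c mod int q \<or> b mod int q = (- c) mod int q"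
        by (simp only: mod_eq_dvd_iff)
      then show ?thesis
        using b c by auto
    qed
    then have "?R a \<subseteq> {c, (- c) mod int q}"
      by blast
    then have "card (?R a) \<le> card {c, (- c) mod int q}"
      by (intro card_mono) auto
    also have "\<dots> \<le> 2"
      by (simp add: card_insert_if)
    finally show ?thesis .
  qed
  then have "(\<Sum>a\<in>{0..<int q}. card (?R a)) \<le> (\<Sum>a\<in>{0..<int q}. 2)"
    by (intro sum_mono)
  moreover have SO2: "SO2 = Sigma {0..<int q} ?R"
    by (auto simp: SO2_def V_def dot_def)
  have "card SO2 = (\<Sum>a\<in>{0..<int q}. card (?R a))"
    unfolding SO2 by (intro card_SigmaI ballI finite_subset[OF Collect_restrict] finite_atLeastLessThan_int)
  ultimately show ?thesis
    by simp
qed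

text \<open>A nonzero frequency is nonzero in at least one plane, where the image determines the
  rotation; only the rotation of the other plane remains free. This saves a factor of order
  \<open>q\<close> over the total number of rotations.\<close>

lemma card_rotations_le:
  assumes "\<xi> \<in> W" "\<xi> \<noteq> 0"
  shows "card {r \<in> SO2 \<times> SO2. red4 (rot4 (conj4 r) \<xi>) = \<eta>} \<le> 2 * q"
proof -
  let ?R = "\<lambda>v w. {r \<in> SO2. red2 (rot (conj2 r) v) = w}"
  have le: "card (?R v w) \<le> 2 * q" for v w
    using card_mono[of SO2 "?R v w"] card_SO2_le by auto
  have le1: "card (?R v w) \<le> 1" if "v \<in> V" "v \<noteq> 0" for v w
  proof -
    have "\<not> null2 v"
      using that eq_if_null2_diff[of v 0] q_pos by (auto simp: V_def zero_prod_def)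
    then have "\<forall>r\<in>?R v w. \<forall>r'\<in>?R v w. r = r'"
      using rotation_unique red2_eq_iff by (metis (mono_tags, lifting) mem_Collect_eq)
    then show ?thesis
      by (metis (no_types, lifting) One_nat_def card_le_Suc0_iff_eq finite_SO2 finite_subset mem_Collect_eq subsetI)
  qed
  have "{r \<in> SO2 \<times> SO2. red4 (rot4 (conj4 r) \<xi>) = \<eta>} = ?R (fst \<xi>) (fst \<eta>) \<times> ?R (snd \<xi>) (snd \<eta>)"
    by (auto simp: red4_def rot4_def conj4_def)
  then have card: "card {r \<in> SO2 \<times> SO2. red4 (rot4 (conj4 r) \<xi>) = \<eta>} =
      card (?R (fst \<xi>) (fst \<eta>)) * card (?R (snd \<xi>) (snd \<eta>))"
    by simp
  have "fst \<xi> \<noteq> 0 \<or> snd \<xi> \<noteq> 0"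
    using assms(2) by (simp add: prod_eq_iff)
  then show ?thesis
  proof
    assume "fst \<xi> \<noteq> 0"
    then show ?thesis
      unfolding card using mult_le_mono[OF le1 le] assms(1) by (simp add: W_def mem_Times_iff)
  next
    assume "snd \<xi> \<noteq> 0"
    then show ?thesis
      unfolding card using mult_le_mono[OF le le1] assms(1) by (simp add: W_def mem_Times_iff)
  qed
qed

text \<open>Rotations preserve both norms, so an orbit stays in one product of circles, where
  \<open>restriction\<close> applies.\<close>

lemma red4_rot4_in_sphere:
  assumes "r \<in> SO2 \<times> SO2"
  shows "red4 (rot4 (conj4 r) \<xi>) \<in> sphere (dot (fst \<xi>) (fst \<xi>)) (dot (snd \<xi>) (snd \<xi>))"
proof -
  have "[dot (red2 (rot (conj2 s) v)) (red2 (rot (conj2 s) v)) = dot v v] (mod int q)"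
    if "s \<in> SO2" for s v
  proof -
    have "[dot s s * dot v v = 1 * dot v v] (mod int q)"
      using that by (intro cong_scalar_right) (simp add: SO2_def)
    moreover have "dot (conj2 s) (conj2 s) = dot s s"
      by (simp add: conj2_def dot_def)
    ultimately show ?thesis
      using dot_red2[of "rot (conj2 s) v"] dot_rot_self[of "conj2 s" v] by (metis cong_trans mult_1)
  qed
  then show ?thesis
    using assms by (simp add: sphere_def red4_def rot4_def conj4_def W_def red2_in_V mem_Times_iff)
qed

lemma hat_red4: "hat A (red4 \<xi>) = hat A \<xi>"
proof -
  have "[pairing x (red4 \<xi>) = pairing x \<xi>] (mod int q)" for x
    unfolding pairing_def dot_def red4_def red2_def by (intro cong_add cong_mult) simp_all
  then show ?thesis
    unfolding hat_def by (intro sum.cong refl e_cong)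
qed

section \<open>Pairs of equal norms\<close>

definition same_norms :: "vec4 \<Rightarrow> vec4 \<Rightarrow> bool" where
  "same_norms u v \<longleftrightarrow> [dot (fst u) (fst u) = dot (fst v) (fst v)] (mod int q)
    \<and> [dot (snd u) (snd u) = dot (snd v) (snd v)] (mod int q)"

lemma sphere_eq_same_norms:
  "sphere (dot (fst \<xi>) (fst \<xi>)) (dot (snd \<xi>) (snd \<xi>)) = {\<eta> \<in> W. same_norms \<eta> \<xi>}"
  by (simp add: sphere_def same_norms_def)

lemma exists_rotation4:
  assumes "same_norms u v"
  shows "\<exists>r\<in>SO2 \<times> SO2. null4 (u - rot4 r v)"
proof -
  obtain r s where "r \<in> SO2" "null2 (fst u - rot r (fst v))" "s \<in> SO2" "null2 (snd u - rot s (snd v))"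
    using assms exists_rotation unfolding same_norms_def by meson
  then show ?thesis
    by (intro bexI[of _ "(r, s)"]) (simp_all add: null4_def rot4_def)
qed

definition norm_energy :: "vec4 set \<Rightarrow> vec4 set \<Rightarrow> real" where
  "norm_energy E F = (\<Sum>j\<in>E \<times> F. \<Sum>k\<in>E \<times> F. if same_norms (fst j - snd j) (fst k - snd k) then 1 else 0)"

text \<open>Every quadruple with equal norms is realised by at least one rotation \<open>r\<close>.
  For fixed \<open>r\<close>, \<open>parseval\<close> counts the solutions, and the adjoint moves
  the rotation onto the frequency.\<close>

lemma norm_energy_le_fourier:
  "real q ^ 4 * norm_energy E F \<le>
    (\<Sum>r\<in>SO2 \<times> SO2. \<Sum>\<xi>\<in>W. cmod (hat E \<xi>) * cmod (hat F \<xi>)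
      * (cmod (hat E (rot4 (conj4 r) \<xi>)) * cmod (hat F (rot4 (conj4 r) \<xi>))))"
proof -
  define G where "G = (\<lambda>\<xi>. hat E \<xi> * cnj (hat F \<xi>))"
  \<comment> \<open>The number of solutions of \<open>x - y = r (z - w)\<close> modulo
    \<open>q\<close>.\<close>
  define M where "M = (\<lambda>r. \<Sum>j\<in>E \<times> F. \<Sum>k\<in>E \<times> F.
    if null4 ((fst j - snd j) - rot4 r (fst k - snd k)) then 1 else (0::real))"
  have G: "(\<Sum>j\<in>E \<times> F. e (pairing (fst j - snd j) \<xi>)) = G \<xi>" for \<xi>
  proof -
    have "e (pairing (x - y) \<xi>) = e (pairing x \<xi>) * cnj (e (pairing y \<xi>))" for x y
      by (simp add: cnj_e pairing_def dot_def algebra_simps flip: e_add)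
    then show ?thesis
      by (simp add: G_def hat_def sum_product sum.cartesian_product case_prod_beta)
  qed
  have M_le: "real q ^ 4 * M r \<le> (\<Sum>\<xi>\<in>W. cmod (G \<xi>) * cmod (G (rot4 (conj4 r) \<xi>)))" for r
  proof -
    have "complex_of_real (real q ^ 4 * M r) = of_nat q ^ 4 * (\<Sum>j\<in>E \<times> F. \<Sum>k\<in>E \<times> F.
        if null4 ((fst j - snd j) - rot4 r (fst k - snd k)) then 1 * cnj 1 else 0)"
      by (simp add: M_def if_distrib cong: if_cong)
    also have "\<dots> = (\<Sum>\<xi>\<in>W. (\<Sum>j\<in>E \<times> F. 1 * e (pairing (fst j - snd j) \<xi>))
        * cnj (\<Sum>k\<in>E \<times> F. 1 * e (pairing (rot4 r (fst k - snd k)) \<xi>)))"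
      by (rule parseval[symmetric])
    also have "\<dots> = (\<Sum>\<xi>\<in>W. G \<xi> * cnj (G (rot4 (conj4 r) \<xi>)))"
      by (simp only: mult_1 pairing_rot4 G)
    finally have "cmod (complex_of_real (real q ^ 4 * M r)) = cmod (\<Sum>\<xi>\<in>W. G \<xi> * cnj (G (rot4 (conj4 r) \<xi>)))"
      by simp
    moreover have "real q ^ 4 * M r \<ge> 0"
      by (simp add: M_def sum_nonneg)
    ultimately have "real q ^ 4 * M r = cmod (\<Sum>\<xi>\<in>W. G \<xi> * cnj (G (rot4 (conj4 r) \<xi>)))"
      by (simp only: norm_of_real abs_of_nonneg)
    also have "\<dots> \<le> (\<Sum>\<xi>\<in>W. cmod (G \<xi>) * cmod (G (rot4 (conj4 r) \<xi>)))"
      by (rule sum_norm_le) (simp add: norm_mult)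
    finally show ?thesis .
  qed
  have "norm_energy E F \<le> (\<Sum>j\<in>E \<times> F. \<Sum>k\<in>E \<times> F. \<Sum>r\<in>SO2 \<times> SO2.
      if null4 ((fst j - snd j) - rot4 r (fst k - snd k)) then 1 else 0)"
    unfolding norm_energy_def
  proof (intro sum_mono)
    fix j k
    let ?g = "\<lambda>r. if null4 ((fst j - snd j) - rot4 r (fst k - snd k)) then 1 else (0::real)"
    show "(if same_norms (fst j - snd j) (fst k - snd k) then 1 else 0) \<le> sum ?g (SO2 \<times> SO2)"
    proof (cases "same_norms (fst j - snd j) (fst k - snd k)")
      case True
      then obtain r where "r \<in> SO2 \<times> SO2" "null4 ((fst j - snd j) - rot4 r (fst k - snd k))"
        using exists_rotation4 by blast
      then show ?thesis
        using True member_le_sum[of r "SO2 \<times> SO2" ?g] by simp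
    qed (simp add: sum_nonneg)
  qed
  also have "\<dots> = (\<Sum>j\<in>E \<times> F. \<Sum>r\<in>SO2 \<times> SO2. \<Sum>k\<in>E \<times> F.
      if null4 ((fst j - snd j) - rot4 r (fst k - snd k)) then 1 else 0)"
    by (intro sum.cong refl sum.swap)
  also have "\<dots> = (\<Sum>r\<in>SO2 \<times> SO2. M r)"
    unfolding M_def by (rule sum.swap)
  finally have "real q ^ 4 * norm_energy E F \<le> real q ^ 4 * (\<Sum>r\<in>SO2 \<times> SO2. M r)"
    by (intro mult_left_mono) auto
  also have "\<dots> \<le> (\<Sum>r\<in>SO2 \<times> SO2. \<Sum>\<xi>\<in>W. cmod (G \<xi>) * cmod (G (rot4 (conj4 r) \<xi>)))"
    unfolding sum_distrib_left by (intro sum_mono M_le)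
  finally show ?thesis
    by (simp add: G_def norm_mult)
qed

text \<open>The zero frequency is fixed by all rotations and gives the first term. Elsewhere the sum
  over rotations is at most \<open>2 * q\<close> times a sum over the sphere through the frequency,
  where \<open>restriction\<close> controls the transform of \<open>E\<close> and
  \<open>plancherel\<close> that of \<open>F\<close>.\<close>

lemma norm_energy_le:
  assumes E: "E \<subseteq> W" and F: "F \<subseteq> W"
  shows "norm_energy E F \<le> 4 * (real (card E) * real (card F))\<^sup>2 / (real q)\<^sup>2
    + 6 * real q ^ 3 * (real (card E) * sqrt (real (card E))) * real (card F)"
proof -
  define x y where "x = real (card E)" and "y = real (card F)"
  define f g where "f = (\<lambda>\<xi>. cmod (hat E \<xi>))" and "g = (\<lambda>\<xi>. cmod (hat F \<xi>))"
  define h where "h = (\<lambda>\<xi>. f \<xi> * g \<xi>)"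
  have nonneg: "f \<xi> \<ge> 0" "g \<xi> \<ge> 0" "h \<xi> \<ge> 0" for \<xi>
    by (simp_all add: f_def g_def h_def)
  have zero_W: "0 \<in> W"
    using q_pos by (simp add: W_def V_def zero_prod_def)
  have h_red4: "h (red4 \<xi>) = h \<xi>" for \<xi>
    by (simp add: h_def f_def g_def hat_red4)
  have h0: "h 0 = x * y"
    by (simp add: h_def f_def g_def hat_def pairing_def dot_def x_def y_def e_eq_1_if_dvd)
  have rot_zero: "rot4 r 0 = 0" for r
    by (simp add: rot4_def rot_def prod_eq_iff)
  have card_SO: "real (card (SO2 \<times> SO2)) \<le> 4 * (real q)\<^sup>2"
  proof -
    have "card SO2 * card SO2 \<le> (2 * q) * (2 * q)"
      using card_SO2_le by (intro mult_le_mono)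
    then have "real (card SO2 * card SO2) \<le> real ((2 * q) * (2 * q))"
      by (simp only: of_nat_le_iff)
    then show ?thesis
      by (simp add: card_cartesian_product power2_eq_square)
  qed
  have orbit: "(\<Sum>r\<in>SO2 \<times> SO2. h (rot4 (conj4 r) \<xi>)) \<le> 2 * real q * (\<Sum>\<eta> | \<eta> \<in> W \<and> same_norms \<eta> \<xi>. h \<eta>)"
    if "\<xi> \<in> W - {0}" for \<xi>
  proof -
    let ?m = "\<lambda>r. red4 (rot4 (conj4 r) \<xi>)" and ?S = "{\<eta> \<in> W. same_norms \<eta> \<xi>}"
    have "(\<Sum>r\<in>SO2 \<times> SO2. h (rot4 (conj4 r) \<xi>)) = (\<Sum>r\<in>SO2 \<times> SO2. h (?m r))"
      by (simp add: h_red4)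
    also have "\<dots> = (\<Sum>\<eta>\<in>?S. \<Sum>r | r \<in> SO2 \<times> SO2 \<and> ?m r = \<eta>. h (?m r))"
      using red4_rot4_in_sphere[of _ \<xi>]
      by (intro sum.group[symmetric]) (auto simp: sphere_eq_same_norms)
    also have "\<dots> = (\<Sum>\<eta>\<in>?S. real (card {r \<in> SO2 \<times> SO2. ?m r = \<eta>}) * h \<eta>)"
      by (intro sum.cong refl) simp
    also have "\<dots> \<le> (\<Sum>\<eta>\<in>?S. 2 * real q * h \<eta>)"
    proof (intro sum_mono mult_right_mono nonneg)
      fix \<eta>
      have "card {r \<in> SO2 \<times> SO2. ?m r = \<eta>} \<le> 2 * q"
        using that by (intro card_rotations_le) auto
      from of_nat_mono[OF this, where 'a = real]
      show "real (card {r \<in> SO2 \<times> SO2. ?m r = \<eta>}) \<le> 2 * real q"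
        by (simp only: of_nat_mult of_nat_numeral)
    qed
    finally show ?thesis
      by (simp add: sum_distrib_left)
  qed
  \<comment> \<open>The square root of the bound in \<open>restriction\<close>.\<close>
  let ?K = "3 * (real q)\<^sup>2 * (x * sqrt x)"
  have sphere_le: "(\<Sum>\<eta> | \<eta> \<in> W \<and> same_norms \<eta> \<xi>. (f \<eta>)\<^sup>2) \<le> ?K" for \<xi>
  proof (rule power2_le_imp_le)
    have "(sqrt x)\<^sup>2 = x"
      by (simp add: x_def)
    then have "?K\<^sup>2 = 9 * real q ^ 4 * x ^ 3"
      by (simp add: power_mult_distrib power3_eq_cube power2_eq_square[of x] flip: power_mult)
    then show "(\<Sum>\<eta> | \<eta> \<in> W \<and> same_norms \<eta> \<xi>. (f \<eta>)\<^sup>2)\<^sup>2 \<le> ?K\<^sup>2"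
      using restriction[OF E] unfolding f_def x_def sphere_eq_same_norms[symmetric] by simp
    show "?K \<ge> 0"
      by (simp add: x_def)
  qed
  have sym: "same_norms u v = same_norms v u" for u v
    by (auto simp: same_norms_def intro: cong_sym)
  define T where "T = (\<Sum>\<xi>\<in>W. \<Sum>\<eta> | \<eta> \<in> W \<and> same_norms \<eta> \<xi>. (g \<xi>)\<^sup>2 * (f \<eta>)\<^sup>2)"
  \<comment> \<open>AM-GM is arranged to pair the transform of \<open>F\<close> at one frequency
    with that of \<open>E\<close> at the other. Both halves equal \<open>T\<close> by symmetry, and
    the inner sum in \<open>T\<close> involves only \<open>E\<close>.\<close>
  have "(\<Sum>\<xi>\<in>W. \<Sum>\<eta> | \<eta> \<in> W \<and> same_norms \<eta> \<xi>. h \<xi> * h \<eta>)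
      \<le> (\<Sum>\<xi>\<in>W. \<Sum>\<eta> | \<eta> \<in> W \<and> same_norms \<eta> \<xi>. ((g \<xi>)\<^sup>2 * (f \<eta>)\<^sup>2 + (g \<eta>)\<^sup>2 * (f \<xi>)\<^sup>2) / 2)"
  proof (intro sum_mono)
    fix \<xi> \<eta>
    show "h \<xi> * h \<eta> \<le> ((g \<xi>)\<^sup>2 * (f \<eta>)\<^sup>2 + (g \<eta>)\<^sup>2 * (f \<xi>)\<^sup>2) / 2"
      using sum_squares_bound[of "g \<xi> * f \<eta>" "g \<eta> * f \<xi>"]
      by (simp add: h_def power_mult_distrib mult_ac)
  qed
  also have "\<dots> = (T + (\<Sum>\<xi>\<in>W. \<Sum>\<eta> | \<eta> \<in> W \<and> same_norms \<eta> \<xi>. (g \<eta>)\<^sup>2 * (f \<xi>)\<^sup>2)) / 2"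
    by (simp add: T_def sum.distrib flip: sum_divide_distrib)
  also have "(\<Sum>\<xi>\<in>W. \<Sum>\<eta> | \<eta> \<in> W \<and> same_norms \<eta> \<xi>. (g \<eta>)\<^sup>2 * (f \<xi>)\<^sup>2) = T"
    using sum.swap_restrict[of W W "\<lambda>\<xi> \<eta>. (g \<eta>)\<^sup>2 * (f \<xi>)\<^sup>2" "\<lambda>\<xi> \<eta>. same_norms \<eta> \<xi>"]
    by (simp add: T_def sym)
  also have "(T + T) / 2 = T"
    by simp
  also have "T = (\<Sum>\<xi>\<in>W. (g \<xi>)\<^sup>2 * (\<Sum>\<eta> | \<eta> \<in> W \<and> same_norms \<eta> \<xi>. (f \<eta>)\<^sup>2))"
    by (simp only: T_def sum_distrib_left)
  also have "\<dots> \<le> (\<Sum>\<xi>\<in>W. (g \<xi>)\<^sup>2 * ?K)"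
    by (rule sum_mono, rule mult_left_mono[OF sphere_le]) simp
  also have "\<dots> = (\<Sum>\<xi>\<in>W. (g \<xi>)\<^sup>2) * ?K"
    by (simp only: sum_distrib_right)
  also have "(\<Sum>\<xi>\<in>W. (g \<xi>)\<^sup>2) = real q ^ 4 * y"
    unfolding g_def y_def by (rule plancherel[OF F])
  finally have pairs: "(\<Sum>\<xi>\<in>W. \<Sum>\<eta> | \<eta> \<in> W \<and> same_norms \<eta> \<xi>. h \<xi> * h \<eta>) \<le> real q ^ 4 * y * ?K" .
  have "real q ^ 4 * norm_energy E F \<le> (\<Sum>r\<in>SO2 \<times> SO2. \<Sum>\<xi>\<in>W. h \<xi> * h (rot4 (conj4 r) \<xi>))"
    using norm_energy_le_fourier[of E F] by (simp add: h_def f_def g_def)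
  also have "\<dots> = (\<Sum>\<xi>\<in>W. h \<xi> * (\<Sum>r\<in>SO2 \<times> SO2. h (rot4 (conj4 r) \<xi>)))"
    unfolding sum_distrib_left by (rule sum.swap)
  also have "\<dots> = h 0 * (\<Sum>r\<in>SO2 \<times> SO2. h 0)
      + (\<Sum>\<xi>\<in>W - {0}. h \<xi> * (\<Sum>r\<in>SO2 \<times> SO2. h (rot4 (conj4 r) \<xi>)))"
    using zero_W by (simp add: sum.remove rot_zero)
  also have "\<dots> \<le> 4 * (real q)\<^sup>2 * (x * y)\<^sup>2 + 2 * real q * (real q ^ 4 * y * ?K)"
  proof (rule add_mono)
    have "(x * y)\<^sup>2 * real (card (SO2 \<times> SO2)) \<le> (x * y)\<^sup>2 * (4 * (real q)\<^sup>2)"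
      by (intro mult_left_mono card_SO) simp
    then show "h 0 * (\<Sum>r\<in>SO2 \<times> SO2. h 0) \<le> 4 * (real q)\<^sup>2 * (x * y)\<^sup>2"
      by (simp add: h0 power2_eq_square mult_ac del: card_cartesian_product)
    have "(\<Sum>\<xi>\<in>W - {0}. h \<xi> * (\<Sum>r\<in>SO2 \<times> SO2. h (rot4 (conj4 r) \<xi>)))
        \<le> (\<Sum>\<xi>\<in>W - {0}. h \<xi> * (2 * real q * (\<Sum>\<eta> | \<eta> \<in> W \<and> same_norms \<eta> \<xi>. h \<eta>)))"
      by (intro sum_mono mult_left_mono orbit nonneg)
    \<comment> \<open>All terms are nonnegative, so the zero frequency may be restored to match
      \<open>pairs\<close>.\<close>
    also have "\<dots> \<le> (\<Sum>\<xi>\<in>W. h \<xi> * (2 * real q * (\<Sum>\<eta> | \<eta> \<in> W \<and> same_norms \<eta> \<xi>. h \<eta>)))"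
      by (intro sum_mono2) (auto intro!: mult_nonneg_nonneg sum_nonneg nonneg)
    also have "\<dots> = 2 * real q * (\<Sum>\<xi>\<in>W. \<Sum>\<eta> | \<eta> \<in> W \<and> same_norms \<eta> \<xi>. h \<xi> * h \<eta>)"
      by (simp add: sum_distrib_left mult_ac)
    also have "\<dots> \<le> 2 * real q * (real q ^ 4 * y * ?K)"
      by (intro mult_left_mono pairs) simp
    finally show "(\<Sum>\<xi>\<in>W - {0}. h \<xi> * (\<Sum>r\<in>SO2 \<times> SO2. h (rot4 (conj4 r) \<xi>)))
        \<le> 2 * real q * (real q ^ 4 * y * ?K)" .
  qed
  finally have "real q ^ 4 * norm_energy E F \<le> 4 * (real q)\<^sup>2 * (x * y)\<^sup>2 + 2 * real q * (real q ^ 4 * y * ?K)" .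
  also have "\<dots> = real q ^ 4 * (4 * (x * y)\<^sup>2 / (real q)\<^sup>2 + 6 * real q ^ 3 * (x * sqrt x) * y)"
  proof -
    have "4 * Q\<^sup>2 * a\<^sup>2 + 2 * Q * (Q ^ 4 * y * (3 * Q\<^sup>2 * b)) = Q ^ 4 * (4 * a\<^sup>2 / Q\<^sup>2 + 6 * Q ^ 3 * b * y)"
      if "Q \<noteq> 0" for Q a b y :: real
      using that by (simp add: field_simps eval_nat_numeral)
    then show ?thesis
      using q_pos by simp
  qed
  finally show ?thesis
    unfolding x_def y_def by (rule mult_left_le_imp_le) (use q_pos in simp)
qed

section \<open>From the residue ring to integer vectors\<close>

lemma sqnorm_vdiff: "sqnorm (Fq q) (vdiff (Fq q) u v) = dot (u - v) (u - v) mod int q"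
proof -
  interpret residues "int q" "Fq q"
    using prime_gt_1_nat[OF prime_q] by unfold_locales auto
  have "x \<ominus>\<^bsub>Fq q\<^esub> y = (x - y) mod int q" for x y
    by (simp add: a_minus_def res_add_eq res_neg_eq mod_simps)
  then show ?thesis
    by (simp add: sqnorm_def vdiff_def pow_cong add_cong dot_def power2_eq_square)
qed

lemma space22_eq_W: "space22 (Fq q) = W"
  by (auto simp: space22_def W_def V_def residue_ring_def)

definition norms :: "vec4 \<times> vec4 \<Rightarrow> int \<times> int" where
  "norms j = (let u = fst j - snd j in (dot (fst u) (fst u) mod int q, dot (snd u) (snd u) mod int q))"

lemma B22_eq_image: "B22 (Fq q) E F = norms ` (E \<times> F)"
proof -
  have "B22 (Fq q) E F = {norms (x, y) | x y. x \<in> E \<and> y \<in> F}"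
    unfolding B22_def sqnorm_vdiff norms_def Let_def by force
  then show ?thesis
    by blast
qed

text \<open>Norms are invariant under negation. This allows the smaller set to play the role of
  \<open>E\<close>.\<close>

lemma B22_commute: "B22 (Fq q) E F = B22 (Fq q) F E"
proof -
  have swap: "norms j = norms (prod.swap j)" for j
    by (simp add: norms_def dot_def algebra_simps)
  have "norms ` (E \<times> F) = norms ` prod.swap ` (E \<times> F)"
    unfolding image_image by (rule image_cong[OF refl swap])
  then show ?thesis
    by (simp only: B22_eq_image product_swap)
qed

section \<open>Lower bound for the distance set\<close>

lemma card_square_le_B22_mult_energy:
  assumes "E \<subseteq> W" "F \<subseteq> W"
  shows "(real (card E) * real (card F))\<^sup>2 \<le> real (card (B22 (Fq q) E F)) * norm_energy E F"
proof -
  have "finite (E \<times> F)"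
    using assms by (meson finite_SigmaI finite_W finite_subset)
  moreover have "same_norms (fst j - snd j) (fst k - snd k) \<longleftrightarrow> norms j = norms k" for j k
    by (simp add: same_norms_def norms_def Let_def cong_def)
  ultimately show ?thesis
    using card_square_le_card_image_mult_collisions[of "E \<times> F" norms]
    by (simp add: B22_eq_image norm_energy_def card_cartesian_product)
qed

text \<open>The second term of \<open>norm_energy_le\<close> is dominated by the size of the first
  once \<open>sqrt x * y\<close> is at least a constant times \<open>q ^ 5\<close>. Since
  \<open>x \<le> y\<close>, the fourth power of \<open>sqrt x * y\<close> is at least
  \<open>(x * y) ^ 3\<close>, so \<open>x * y\<close> of order \<open>q\<close> to the power 20/3 =
  6 + 2/3 suffices.\<close>

lemma card_B22_lower_bound:
  assumes E: "E \<subseteq> W" and F: "F \<subseteq> W" and le: "card E \<le> card F" and C: "C > 0"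
    and large: "real (card E) * real (card F) > C * real q powr (6 + 2/3)"
  shows "real (card (B22 (Fq q) E F)) > 1 / (5 + 6 / C powr (3/4)) * (real q)\<^sup>2"
proof -
  define x y Q b D where "x = real (card E)" and "y = real (card F)" and "Q = real q"
    and "b = real (card (B22 (Fq q) E F))" and "D = C powr (3/4)"
  have Q: "Q > 0" and D: "D > 0"
    using q_pos C by (simp_all add: Q_def D_def)
  have xy: "x * y > C * Q powr (6 + 2/3)"
    using large by (simp add: x_def y_def Q_def)
  have xy_pos: "x * y > 0"
    using xy C Q by (smt (verit) mult_pos_pos powr_gt_zero)
  then have x: "x > 0" and y: "y > 0"
    by (auto simp: x_def y_def zero_less_mult_iff)
  define s where "s = sqrt x * y"
  \<comment> \<open>Comparing fourth powers fixes the choice of \<open>D\<close>, whose fourth power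
    is \<open>C ^ 3\<close>.\<close>
  have "(D * Q ^ 5) ^ 4 = C ^ 3 * Q ^ 20"
  proof -
    have "D ^ 4 = C ^ 3"
      using C by (simp add: D_def powr_power)
    then show ?thesis
      by (simp add: power_mult_distrib flip: power_mult)
  qed
  also have "\<dots> = (C * Q powr (6 + 2/3)) ^ 3"
    using Q by (simp add: power_mult_distrib powr_power)
  also have "\<dots> \<le> (x * y) ^ 3"
    using xy C by (intro power_mono) auto
  also have "\<dots> = x\<^sup>2 * y ^ 3 * x"
    by (simp add: power_mult_distrib eval_nat_numeral)
  also have "\<dots> \<le> x\<^sup>2 * y ^ 3 * y"
    using le x y by (intro mult_left_mono) (auto simp: x_def y_def)
  also have "\<dots> = s ^ 4"
  proof -
    have "sqrt x ^ 4 = x\<^sup>2"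
      using x by (simp add: power4_eq_xxxx power2_eq_square mult.assoc)
    then show ?thesis
      by (simp add: s_def power_mult_distrib eval_nat_numeral)
  qed
  finally have "(D * Q ^ 5) ^ 4 \<le> s ^ 4" .
  moreover have "D * Q ^ 5 \<ge> 0" "s \<ge> 0"
    using D Q x y by (simp_all add: s_def)
  ultimately have DQ: "D * Q ^ 5 \<le> s"
    by (simp only: power_mono_iff zero_less_numeral)
  have "Q ^ 5 = Q ^ 3 * Q\<^sup>2"
    by (simp flip: power_add)
  then have "6 * Q ^ 3 * (x * sqrt x) * y * Q\<^sup>2 * D = 6 * (x * s) * (D * Q ^ 5)"
    by (simp only: s_def mult_ac)
  also have "\<dots> \<le> 6 * (x * s) * s"
    using DQ x y by (intro mult_left_mono) (auto simp: s_def)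
  also have "\<dots> = 6 * (x * y)\<^sup>2"
    using x by (simp add: s_def power2_eq_square)
  finally have "6 * Q ^ 3 * (x * sqrt x) * y \<le> 6 / D * (x * y)\<^sup>2 / Q\<^sup>2"
    using Q D by (simp add: field_simps)
  moreover have "norm_energy E F \<le> 4 * (x * y)\<^sup>2 / Q\<^sup>2 + 6 * Q ^ 3 * (x * sqrt x) * y"
    using norm_energy_le[OF E F] by (simp add: x_def y_def Q_def)
  ultimately have energy: "norm_energy E F \<le> (4 + 6 / D) * (x * y)\<^sup>2 / Q\<^sup>2"
    by (simp add: add_divide_distrib distrib_right)
  have "(x * y)\<^sup>2 \<le> b * norm_energy E F"
    unfolding x_def y_def b_def by (rule card_square_le_B22_mult_energy[OF E F])
  also have "\<dots> \<le> b * ((4 + 6 / D) * (x * y)\<^sup>2 / Q\<^sup>2)"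
    using energy by (intro mult_left_mono) (auto simp: b_def)
  finally have "(x * y)\<^sup>2 * Q\<^sup>2 \<le> (x * y)\<^sup>2 * (b * (4 + 6 / D))"
    using Q by (simp add: field_simps)
  then have Q_le: "Q\<^sup>2 \<le> b * (4 + 6 / D)"
    by (rule mult_left_le_imp_le) (rule zero_less_power[OF xy_pos])
  then have "b \<noteq> 0"
    using Q by auto
  then have "b > 0"
    by (simp add: b_def)
  \<comment> \<open>Passing from 4 to 5 makes the inequality strict.\<close>
  then have "Q\<^sup>2 < b * (5 + 6 / D)"
    using Q_le by (simp add: distrib_left)
  then show ?thesis
    using D unfolding b_def[symmetric] Q_def[symmetric] D_def[symmetric]
    by (simp add: pos_divide_less_eq add_pos_pos)
qed

lemma card_V: "card V = q\<^sup>2"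
  by (simp add: V_def card_cartesian_product power2_eq_square)

section \<open>Sharpness of the exponent\<close>

text \<open>Up to sign, differences within the interval take only \<open>m\<close> values, so the
  first norm does too, while the second takes at most \<open>q\<close>. The set itself has
  \<open>m * q\<^sup>2\<close> elements.\<close>

lemma thin_strip:
  assumes "m \<le> q"
  defines "E \<equiv> ({0..<int m} \<times> {0}) \<times> V"
  shows "E \<subseteq> W" "card (B22 (Fq q) E E) \<le> m * q"
proof -
  show "E \<subseteq> W"
    using assms(1) q_pos by (auto simp: E_def W_def V_def)
  let ?T = "(\<lambda>d. (d * d) mod int q) ` {0..<int m} \<times> {0..<int q}"
  have "B22 (Fq q) E E \<subseteq> ?T"
  proof
    fix p assume "p \<in> B22 (Fq q) E E"
    then obtain s t u v where s: "s \<in> {0..<int m}" and t: "t \<in> {0..<int m}"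
      and p: "p = norms (((s, 0), u), ((t, 0), v))"
      by (auto simp: B22_eq_image E_def)
    have "\<bar>s - t\<bar> \<in> {0..<int m}"
      using s t by auto
    then have "((s - t) * (s - t)) mod int q \<in> (\<lambda>d. (d * d) mod int q) ` {0..<int m}"
      by (rule rev_image_eqI) simp
    then show "p \<in> ?T"
      using q_pos by (simp add: p norms_def dot_def)
  qed
  then have "card (B22 (Fq q) E E) \<le> card ?T"
    by (intro card_mono) auto
  also have "\<dots> \<le> m * q"
    using card_image_le[of "{0..<int m}" "\<lambda>d. (d * d) mod int q"] by (simp add: card_cartesian_product)
  finally show "card (B22 (Fq q) E E) \<le> m * q" .
qed

end

theorem theorem1p2:
  shows "(\<forall>C::real. C > 0 \<longrightarrow> (\<exists>c::real. c > 0 \<and>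
            (\<forall>q::nat. prime q \<longrightarrow> [q = 3] (mod 4) \<longrightarrow>
              (\<forall>E F. E \<subseteq> space22 (Fq q) \<longrightarrow> F \<subseteq> space22 (Fq q) \<longrightarrow>
                real (card E) * real (card F) > C * real q powr (6 + 2/3) \<longrightarrow>
                real (card (B22 (Fq q) E F)) > c * (real q)\<^sup>2))))
       \<and> (\<forall>\<alpha>::real. \<alpha> < 6 \<longrightarrow>
          \<not> (\<forall>C::real. C > 0 \<longrightarrow> (\<exists>c::real. c > 0 \<and>
            (\<forall>q::nat. prime q \<longrightarrow> [q = 3] (mod 4) \<longrightarrow>
              (\<forall>E F. E \<subseteq> space22 (Fq q) \<longrightarrow> F \<subseteq> space22 (Fq q) \<longrightarrow>
                real (card E) * real (card F) > C * real q powr \<alpha> \<longrightarrow>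
                real (card (B22 (Fq q) E F)) > c * (real q)\<^sup>2)))))"
proof (intro conjI allI impI)
  fix C :: real assume C: "C > 0"
  let ?c = "1 / (5 + 6 / C powr (3/4))"
  have "?c > 0"
    using C by (simp add: add_pos_pos)
  moreover have "real (card (B22 (Fq q) E F)) > ?c * (real q)\<^sup>2"
    if q: "prime q" "[q = 3] (mod 4)" and EF: "E \<subseteq> space22 (Fq q)" "F \<subseteq> space22 (Fq q)"
      and large: "real (card E) * real (card F) > C * real q powr (6 + 2/3)" for q E F
  proof -
    interpret prime_3_mod_4 q
      using q by unfold_locales
    show ?thesis
    proof (cases "card E \<le> card F")
      case True
      then show ?thesis
        using card_B22_lower_bound EF C large by (simp add: space22_eq_W)
    next
      case False
      then show ?thesis
        using card_B22_lower_bound[of F E C] EF C large B22_commute[of E F]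
        by (simp add: space22_eq_W mult.commute)
    qed
  qed
  ultimately show "\<exists>c>0. \<forall>q. prime q \<longrightarrow> [q = 3] (mod 4) \<longrightarrow>
      (\<forall>E F. E \<subseteq> space22 (Fq q) \<longrightarrow> F \<subseteq> space22 (Fq q) \<longrightarrow>
        real (card E) * real (card F) > C * real q powr (6 + 2/3) \<longrightarrow>
        real (card (B22 (Fq q) E F)) > c * (real q)\<^sup>2)"
    by (intro exI[of _ ?c]) blast
next
  fix \<alpha> :: real assume \<alpha>: "\<alpha> < 6"
  show "\<not> (\<forall>C::real. C > 0 \<longrightarrow> (\<exists>c::real. c > 0 \<and>
            (\<forall>q::nat. prime q \<longrightarrow> [q = 3] (mod 4) \<longrightarrow>
              (\<forall>E F. E \<subseteq> space22 (Fq q) \<longrightarrow> F \<subseteq> space22 (Fq q) \<longrightarrow>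
                real (card E) * real (card F) > C * real q powr \<alpha> \<longrightarrow>
                real (card (B22 (Fq q) E F)) > c * (real q)\<^sup>2))))"
  proof
    assume "\<forall>C::real. C > 0 \<longrightarrow> (\<exists>c::real. c > 0 \<and>
            (\<forall>q::nat. prime q \<longrightarrow> [q = 3] (mod 4) \<longrightarrow>
              (\<forall>E F. E \<subseteq> space22 (Fq q) \<longrightarrow> F \<subseteq> space22 (Fq q) \<longrightarrow>
                real (card E) * real (card F) > C * real q powr \<alpha> \<longrightarrow>
                real (card (B22 (Fq q) E F)) > c * (real q)\<^sup>2)))"
    from this[rule_format, of 1] obtain c :: real where "c > 0" and
      c: "\<And>q E F. \<lbrakk>prime q; [q = 3] (mod 4); E \<subseteq> space22 (Fq q); F \<subseteq> space22 (Fq q);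
        real (card E) * real (card F) > real q powr \<alpha>\<rbrakk>
        \<Longrightarrow> real (card (B22 (Fq q) E F)) > c * (real q)\<^sup>2"
      by auto
    \<comment> \<open>The cap at 1 keeps the interval length \<open>m\<close> at most
      \<open>q\<close>.\<close>
    define d where "d = min c 1"
    have d: "d > 0" "d \<le> c" "d \<le> 1"
      using \<open>c > 0\<close> by (auto simp: d_def)
    \<comment> \<open>The first threshold gives \<open>d * q \<ge> 2\<close>, so rounding down to
      \<open>m\<close> loses at most half; the second gives
      \<open>d\<^sup>2 * q ^ 6 > 4 * q powr \<alpha>\<close>, where the 4 pays for that loss after
      squaring.\<close>
    obtain q where q: "prime q" "[q = 3] (mod 4)"
      and "q > nat \<lceil>max (2 / d) ((4 / d\<^sup>2) powr (1 / (6 - \<alpha>)))\<rceil>"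
      using exists_prime_3_mod_4_greater by blast
    then have big: "real q > 2 / d" "real q > (4 / d\<^sup>2) powr (1 / (6 - \<alpha>))"
      by linarith+
    interpret prime_3_mod_4 q
      using q by unfold_locales
    have q0: "real q > 0"
      using q_pos by simp
    define m where "m = nat \<lfloor>d * real q\<rfloor>"
    have dq: "d * real q \<ge> 2"
      using big(1) d by (simp add: field_simps)
    have m_le: "real m \<le> d * real q" and m_ge: "real m \<ge> d * real q / 2"
      using dq unfolding m_def by linarith+
    have "d * real q \<le> 1 * real q"
      using d(3) by (intro mult_right_mono) auto
    then have mq: "m \<le> q"
      using m_le by linarith
    let ?E = "({0..<int m} \<times> {0}) \<times> V"
    have "4 / d\<^sup>2 = ((4 / d\<^sup>2) powr (1 / (6 - \<alpha>))) powr (6 - \<alpha>)"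
      using \<alpha> d by (simp add: powr_powr)
    also have "\<dots> < real q powr (6 - \<alpha>)"
      using big(2) \<alpha> by (intro powr_less_mono2) auto
    finally have "4 < d\<^sup>2 * real q powr (6 - \<alpha>)"
      using d by (simp add: field_simps)
    then have "4 * real q powr \<alpha> < d\<^sup>2 * real q powr (6 - \<alpha>) * real q powr \<alpha>"
      using q0 by (intro mult_strict_right_mono) auto
    also have "\<dots> = d\<^sup>2 * real q ^ 6"
      using q0 by (simp add: mult.assoc powr_realpow flip: powr_add)
    also have "\<dots> = 4 * ((d * real q / 2)\<^sup>2 * real q ^ 4)"
      by (simp add: power_mult_distrib power_divide mult.assoc flip: power_add)
    also have "\<dots> \<le> 4 * ((real m)\<^sup>2 * real q ^ 4)"
      using m_ge dq by (intro mult_left_mono mult_right_mono power_mono) auto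
    also have "(real m)\<^sup>2 * real q ^ 4 = real (card ?E) * real (card ?E)"
      by (simp add: card_V power2_eq_square power4_eq_xxxx)
    finally have "real (card ?E) * real (card ?E) > real q powr \<alpha>"
      by simp
    then have "c * (real q)\<^sup>2 < real (card (B22 (Fq q) ?E ?E))"
      using thin_strip(1)[OF mq] q by (intro c) (simp_all add: space22_eq_W)
    also have "\<dots> \<le> real (m * q)"
      using thin_strip(2)[OF mq] by (simp only: of_nat_le_iff)
    also have "\<dots> \<le> d * real q * real q"
      using m_le by (simp add: mult_right_mono)
    also have "\<dots> \<le> c * (real q)\<^sup>2"
      using d(2) by (simp add: power2_eq_square mult.assoc mult_right_mono)
    finally show False
      by simp
  qed
qed

end
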